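(* Let $A$ be a $C^*$-algebra and let $a=(a_1,\ldots,a_n)$ be an $n$-tuple of doubly commuting regular elements of $A$. Then the product $\prod_{i=1}^n a_i = a_1a_2\cdots a_n$ is regular and $$ \Big(\prod_{i=1}^n a_i\Big)^{\dag}=\prod_{i=0}^{n-1} a_{n-i}^{\dag}=\prod_{i=1}^{n} a_i^{\dag}, $$ that is, $(a_1a_2\cdots a_n)^{\dag}=a_n^{\dag}a_{n-1}^{\dag}\cdots a_1^{\dag}=a_1^{\dag}a_2^{\dag}\cdots a_n^{\dag}$.
   Context: An element $x$ of a $C^*$-algebra $A$ is called regular if there exists $y\in A$ with $x=xyx$. Every regular element $x\in A$ has a unique Moore-Penrose inverse $x^{\dag}\in A$, i.e. the unique element satisfying $x=xx^{\dag}x$, $x^{\dag}=x^{\dag}xx^{\dag}$, $(x^{\dag}x)^*=x^{\dag}x$, $(xx^{\dag})^*=xx^{\dag}$. An $n$-tuple $(a_1,\ldots,a_n)$ of elements of $A$ is called doubly commuting if $a_ia_j=a_ja_i$ and $a_ia_j^*=a_j^*a_i$ for all $i,j=1,\ldots,n$ with $i\neq j$. Products $\prod_{i=1}^n x_i$ are taken in the order $x_1x_2\cdots x_n$. *)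

theory Defs
  imports Complex_Main
begin

text \<open>
  C*-algebras, not necessarily unital: the underlying Banach algebra is taken from the library's
  real hierarchy (completeness and submultiplicativity of the norm come from there), and the complex
  scalar multiplication extends the real one.
\<close>

class c_star_algebra = real_normed_algebra + banach +
  fixes scaleC :: "complex \<Rightarrow> 'a \<Rightarrow> 'a"  (infixr "*\<^sub>C" 75)
    and star :: "'a \<Rightarrow> 'a"
  assumes scaleC_add_right: "c *\<^sub>C (x + y) = c *\<^sub>C x + c *\<^sub>C y"
    and scaleC_add_left: "(c + d) *\<^sub>C x = c *\<^sub>C x + d *\<^sub>C x"
    and scaleC_scaleC: "c *\<^sub>C (d *\<^sub>C x) = (c * d) *\<^sub>C x"
    and scaleR_scaleC: "r *\<^sub>R x = complex_of_real r *\<^sub>C x"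
    and mult_scaleC_left: "(c *\<^sub>C x) * y = c *\<^sub>C (x * y)"
    and mult_scaleC_right: "x * (c *\<^sub>C y) = c *\<^sub>C (x * y)"
    and norm_scaleC: "norm (c *\<^sub>C x) = cmod c * norm x"
    and star_add: "star (x + y) = star x + star y"
    and star_scaleC: "star (c *\<^sub>C x) = cnj c *\<^sub>C star x"
    and star_mult: "star (x * y) = star y * star x"
    and star_star: "star (star x) = x"
    and norm_star_mult_self: "norm (star x * x) = (norm x)\<^sup>2"

definition regular :: "'a::c_star_algebra \<Rightarrow> bool" where
  "regular x \<longleftrightarrow> (\<exists>y. x = x * y * x)"

definition is_mp_inverse :: "'a::c_star_algebra \<Rightarrow> 'a \<Rightarrow> bool" where
  "is_mp_inverse x y \<longleftrightarrow>
     x = x * y * x \<and> y = y * x * y \<and> star (y * x) = y * x \<and> star (x * y) = x * y"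

text \<open>Only meaningful for regular elements, where the Moore-Penrose inverse exists uniquely.\<close>

definition mp_inverse :: "'a::c_star_algebra \<Rightarrow> 'a" where
  "mp_inverse x = (THE y. is_mp_inverse x y)"

definition doubly_commuting :: "nat \<Rightarrow> (nat \<Rightarrow> 'a::c_star_algebra) \<Rightarrow> bool" where
  "doubly_commuting n a \<longleftrightarrow>
     (\<forall>i\<in>{1..n}. \<forall>j\<in>{1..n}. i \<noteq> j \<longrightarrow>
        a i * a j = a j * a i \<and> a i * star (a j) = star (a j) * a i)"

text \<open>
  The product from left to right of a nonempty list. The library's \<open>prod_list\<close> is not applicable
  because it needs a unit; correspondingly, the empty product is left unspecified.
\<close>

fun ordered_prod :: "'a::semigroup_mult list \<Rightarrow> 'a" where
  "ordered_prod [x] = x"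
| "ordered_prod (x # y # ys) = x * ordered_prod (y # ys)"

end

theory Submission
  imports Defs "HOL-Analysis.Elementary_Metric_Spaces"
begin

text \<open>
  The only analytic ingredient is the existence of the Moore-Penrose inverse of a regular \<open>x = x y x\<close>.
  For skew-adjoint \<open>k\<close> and large \<open>t\<close>, the C*-identity bounds left multiplication by \<open>k - t\<close> by
  \<open>sqrt (t\<^sup>2 + \<parallel>k\<parallel>\<^sup>2) < 1 + t\<close>, so \<open>1 + k\<close> acts bijectively on \<open>A\<close> by Banach's fixed point theorem; no
  unitization is needed. With \<open>k = e - e*\<close> this makes \<open>1 - k\<^sup>2\<close> invertible and turns an
  idempotent \<open>e\<close> into a projection with the same range; the projections obtained from
  \<open>x y\<close> and \<open>(y x)*\<close> yield the Moore-Penrose inverse. An element commuting with \<open>b\<close> and \<open>b*\<close> commutes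
  with the range projections of \<open>b\<close>, hence with the Moore-Penrose inverse, and the
  four equations for the product can be checked factor by factor.
\<close>

section \<open>The involution\<close>

lemma star_zero [simp]: "star (0::'a::c_star_algebra) = 0"
  using star_add[of "0::'a" 0] by simp

lemma star_minus: "star (- x) = - star (x::'a::c_star_algebra)"
  using star_add[of x "- x"] by (simp add: eq_neg_iff_add_eq_0 add.commute)

lemma star_diff: "star (x - y) = star x - star (y::'a::c_star_algebra)"
  using star_add[of x "- y"] by (simp add: star_minus)

lemma star_scaleR: "star (r *\<^sub>R x) = r *\<^sub>R star (x::'a::c_star_algebra)"
  by (simp add: scaleR_scaleC star_scaleC)

lemma norm_star: "norm (star x) = norm (x::'a::c_star_algebra)"
proof -
  have le: "norm y \<le> norm (star y)" for y :: 'a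
  proof (cases "norm y = 0")
    case False
    have "norm y * norm y \<le> norm (star y) * norm y"
      using norm_mult_ineq[of "star y" y] by (simp add: norm_star_mult_self power2_eq_square)
    with False show ?thesis by simp
  qed simp
  show ?thesis using le[of x] le[of "star x"] by (simp add: star_star)
qed

section \<open>Skew-adjoint elements and range projections of idempotents\<close>

lemma norm_skew_shift:
  fixes k a :: "'a::c_star_algebra"
  assumes "star k = - k"
  shows "norm (k * a - t *\<^sub>R a) \<le> sqrt (t\<^sup>2 + (norm k)\<^sup>2) * norm a"
proof -
  \<comment> \<open>By the C*-identity; the mixed terms in \<open>t\<close> cancel because
    \<open>star k = - k\<close>.\<close>
  have "(norm (k * a - t *\<^sub>R a))\<^sup>2 = norm (t\<^sup>2 *\<^sub>R (star a * a) - star a * (k * (k * a)))"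
    unfolding norm_star_mult_self[symmetric]
    by (simp add: star_diff star_mult star_scaleR assms algebra_simps power2_eq_square)
  also have "\<dots> \<le> t\<^sup>2 * norm (star a * a) + norm (star a * (k * (k * a)))"
    by (rule order_trans[OF norm_triangle_ineq4]) simp
  also have "\<dots> \<le> t\<^sup>2 * (norm a)\<^sup>2 + norm a * (norm k * (norm k * norm a))"
    by (intro add_mono order_trans[OF norm_mult_ineq] mult_mono)
      (auto simp: norm_star norm_star_mult_self power2_eq_square intro!: norm_mult_ineq)
  also have "\<dots> = (sqrt (t\<^sup>2 + (norm k)\<^sup>2) * norm a)\<^sup>2"
    by (simp add: power_mult_distrib algebra_simps power2_eq_square)
  finally show ?thesis
    by (rule power2_le_imp_le) simp
qed

lemma one_plus_skew_bij:
  fixes k b :: "'a::c_star_algebra"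
  assumes skew: "star k = - k"
  shows "\<exists>!z. z + k * z = b"
proof -
  \<comment> \<open>This shift is large enough: the bound for \<open>k - t\<close> becomes the
    square root of t^2 + t, which is below 1 + t. The fixed points of \<open>f\<close> solve (1 + t)
    z = b - (k z - t z).\<close>
  define t where "t = (norm k)\<^sup>2"
  define c where "c = sqrt (t\<^sup>2 + t) / (1 + t)"
  define f where "f z = (1 / (1 + t)) *\<^sub>R (b - (k * z - t *\<^sub>R z))" for z
  have t: "t \<ge> 0" by (simp add: t_def)
  have "sqrt (t\<^sup>2 + t) < 1 + t"
    using t by (intro real_less_lsqrt) (auto simp: power2_eq_square algebra_simps)
  then have c: "0 \<le> c" "c < 1" using t by (auto simp: c_def)
  have fix_iff: "f z = z \<longleftrightarrow> z + k * z = b" for z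
  proof -
    have "f z = z \<longleftrightarrow> (1 + t) *\<^sub>R f z = (1 + t) *\<^sub>R z"
      using t by simp
    also have "(1 + t) *\<^sub>R f z = b - (k * z - t *\<^sub>R z)"
      using t by (simp add: f_def)
    also have "\<dots> = (1 + t) *\<^sub>R z \<longleftrightarrow> z + k * z = b"
      by (auto simp: algebra_simps)
    finally show ?thesis .
  qed
  have "dist (f x) (f y) \<le> c * dist x y" for x y
  proof -
    have "f x - f y = (1 / (1 + t)) *\<^sub>R (k * (y - x) - t *\<^sub>R (y - x))"
      by (simp add: f_def algebra_simps)
    then have "dist (f x) (f y) = norm (k * (y - x) - t *\<^sub>R (y - x)) / (1 + t)"
      using t by (simp add: dist_norm)
    also have "\<dots> \<le> sqrt (t\<^sup>2 + t) * norm (y - x) / (1 + t)"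
      using norm_skew_shift[OF skew, of "y - x" t] t
      by (intro divide_right_mono) (auto simp: t_def)
    finally show ?thesis by (simp add: c_def dist_norm norm_minus_commute)
  qed
  then have "\<exists>!z. f z = z"
    using banach_fix_type[of c f] c by blast
  then show ?thesis by (simp add: fix_iff)
qed

text \<open>Formally 1 - k^2 = (1 - k)(1 + k), and \<open>- k\<close> is skew-adjoint along with
  \<open>k\<close>.\<close>

lemma one_minus_skew_square_bij:
  fixes k b :: "'a::c_star_algebra"
  assumes skew: "star k = - k"
  shows "\<exists>!z. z - k * k * z = b"
proof -
  have bij1: "\<exists>!z. z + k * z = c" for c
    by (rule one_plus_skew_bij[OF skew])
  have bij2: "\<exists>!z. z - k * z = c" for c
    using one_plus_skew_bij[of "- k" c] skew by (simp add: star_minus)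
  have factor: "(z + k * z) - k * (z + k * z) = z - k * k * z" for z
    by (simp add: algebra_simps)
  obtain u where u: "u - k * u = b" using bij2 by blast
  obtain z where "z + k * z = u" using bij1 by blast
  with u have z: "z - k * k * z = b" by (simp flip: factor)
  moreover have "z' = z" if "z' - k * k * z' = b" for z'
    using z that bij1 bij2 unfolding factor[symmetric] by metis
  ultimately show ?thesis by blast
qed

text \<open>Formally the projection is e (1 - k^2)^{-1} e* with k = e - e*. As no unit is available,
  \<open>Z\<close> stands for left multiplication by 1 - k^2, and each identity is checked after
  applying the injective map \<open>Z\<close>.\<close>

lemma idempotent_range_projection:
  fixes e :: "'a::c_star_algebra"
  assumes idem: "e * e = e"
  obtains p where "star p = p" "p * p = p" "p * e = e" "e * p = p"
proof -
  define k where "k = e - star e"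
  define Z where "Z v = v - k * k * v" for v
  have "star k = - k" by (simp add: k_def star_diff star_star)
  then have bij: "\<exists>!v. Z v = b" for b
    unfolding Z_def by (rule one_minus_skew_square_bij)
  then obtain w where w: "Z w = star e" by blast
  have idem': "star e * star e = star e"
    using idem by (metis star_mult)
  have e_assoc: "e * (e * v) = e * v" "star e * (star e * v) = star e * v" for v
    using idem idem' by (simp_all flip: mult.assoc)
  have Z_mult: "Z (v * v') = Z v * v'" for v v'
    by (simp add: Z_def algebra_simps)
  \<comment> \<open>Expanding gives 1 - k^2 = 1 - e - e* + e e* + e* e; multiplying by
    \<open>e\<close> on either side leaves e e* e.\<close>
  have comm: "Z (e * v) = e * Z v" for v
    by (simp add: Z_def k_def algebra_simps idem idem' e_assoc)
  have Ze: "Z e = e * star e * e"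
    by (simp add: Z_def k_def algebra_simps idem idem' e_assoc)
  define p where "p = e * w"
  have Zp: "Z p = e * star e"
    by (simp add: p_def comm w)
  have pe: "p * e = e"
  proof -
    have "Z (p * e) = Z e" by (simp add: Z_mult Zp Ze)
    then show ?thesis using bij by blast
  qed
  have "Z (p * star p) = e * star (p * e)"
    by (simp add: Z_mult Zp star_mult mult.assoc)
  then have "Z (p * star p) = Z p"
    by (simp add: pe Zp)
  then have "p * star p = p"
    using bij by blast
  then have sa: "star p = p" by (metis star_mult star_star)
  moreover have "p * p = p" using \<open>p * star p = p\<close> sa by simp
  moreover have "e * p = p" by (simp add: p_def e_assoc)
  ultimately show ?thesis using pe that by blast
qed

section \<open>Uniqueness and existence of Moore-Penrose inverses\<close>

lemma is_mp_inverseD: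
  assumes "is_mp_inverse x y"
  shows "x * y * x = x" "y * x * y = y" "star (y * x) = y * x" "star (x * y) = x * y"
  using assms unfolding is_mp_inverse_def by (blast intro: sym)+

lemma mp_inverse_unique:
  assumes y: "is_mp_inverse x y" and z: "is_mp_inverse x z"
  shows "y = z"
proof -
  have xyx: "x * y * x = x" and yxy: "y * x * y = y" and xzx: "x * z * x = x" and zxz: "z * x * z = z"
    and sa: "star (x * y) = x * y" "star (y * x) = y * x" "star (x * z) = x * z" "star (z * x) = z * x"
    by (simp_all add: is_mp_inverseD[OF y] is_mp_inverseD[OF z])
  \<comment> \<open>Both \<open>x * y\<close> and \<open>x * z\<close> are projections onto the
    range of \<open>x\<close>, hence equal; below, \<open>y * x\<close> and \<open>z * x\<close>
    share their kernel.\<close>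
  have "x * y = (x * z) * (x * y)" using xzx by (simp flip: mult.assoc)
  also have "\<dots> = star ((x * y) * (x * z))" using sa star_mult[of "x * y" "x * z"] by simp
  also have "(x * y) * (x * z) = x * z" using xyx by (simp flip: mult.assoc)
  finally have xy: "x * y = x * z" using sa by simp
  have "y * x = (y * x) * (z * x)" using xzx by (simp add: mult.assoc)
  also have "\<dots> = star ((z * x) * (y * x))" using sa star_mult[of "z * x" "y * x"] by simp
  also have "(z * x) * (y * x) = z * x" using xyx by (simp add: mult.assoc)
  finally have yx: "y * x = z * x" using sa by simp
  have "y = z * (x * y)" using yxy yx by (simp add: mult.assoc)
  then show ?thesis using zxz by (simp add: xy mult.assoc)
qed

lemma mp_inverse_eq: "is_mp_inverse x y \<Longrightarrow> mp_inverse x = y"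
  unfolding mp_inverse_def using mp_inverse_unique by blast

lemma regular_is_mp_inverse:
  fixes x :: "'a::c_star_algebra"
  assumes "regular x"
  shows "is_mp_inverse x (mp_inverse x)"
proof -
  obtain y where xyx: "x * y * x = x" using assms by (metis regular_def)
  have "(x * y) * (x * y) = x * y" using xyx by (simp flip: mult.assoc)
  then obtain p where p: "star p = p" "p * p = p" "p * (x * y) = x * y" "x * y * p = p"
    by (rule idempotent_range_projection)
  have "(y * x) * (y * x) = y * x" using xyx by (simp add: mult.assoc)
  then have "star (y * x) * star (y * x) = star (y * x)" by (simp flip: star_mult)
  then obtain q where q: "star q = q" "q * q = q" "q * star (y * x) = star (y * x)"
      "star (y * x) * q = q"
    by (rule idempotent_range_projection)
  have q1: "y * x * q = y * x" using arg_cong[OF q(3), of star] by (simp only: star_mult star_star q(1))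
  have q2: "q * (y * x) = q" using arg_cong[OF q(4), of star] by (simp only: star_mult star_star q(1))
  have px: "p * x = x" using arg_cong[OF p(3), of "\<lambda>u. u * x"] by (simp only: mult.assoc) (simp add: xyx flip: mult.assoc)
  have xq: "x * q = x" using arg_cong[OF q1, of "\<lambda>u. x * u"] by (simp add: xyx flip: mult.assoc)
  \<comment> \<open>Compressing \<open>y\<close> by the two projections keeps it an inner inverse of
    \<open>x\<close> and turns the idempotents \<open>x * y\<close> and \<open>y * x\<close> into
    \<open>p\<close> and \<open>q\<close>.\<close>
  define z where "z = q * y * p"
  have xz: "x * z = p" using xq p(4) by (simp add: z_def flip: mult.assoc)
  have zx: "z * x = q" using px q2 by (simp add: z_def mult.assoc)
  have "is_mp_inverse x z"
    unfolding is_mp_inverse_def xz zx using px p(1) q(1,2) by (simp add: z_def flip: mult.assoc)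
  then show ?thesis by (simp add: mp_inverse_eq)
qed

lemma regular_if_mp_inverse: "is_mp_inverse x y \<Longrightarrow> regular x"
  unfolding is_mp_inverse_def regular_def by blast

section \<open>Commutation with an element and its adjoint\<close>

definition star_commute :: "'a::c_star_algebra \<Rightarrow> 'a \<Rightarrow> bool" where
  "star_commute x y \<longleftrightarrow> x * y = y * x \<and> x * star y = star y * x"

lemma star_commute_sym: "star_commute x y \<Longrightarrow> star_commute y x"
  unfolding star_commute_def by (metis star_mult star_star)

lemma star_commute_star: "star_commute x y \<Longrightarrow> star_commute (star x) y"
  unfolding star_commute_def by (metis star_mult star_star)

lemma star_commute_mult:
  "star_commute x y \<Longrightarrow> star_commute x z \<Longrightarrow> star_commute x (y * z)"
  unfolding star_commute_def star_mult by (metis mult.assoc)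

lemma star_commute_ordered_prod:
  "ys \<noteq> [] \<Longrightarrow> \<forall>y\<in>set ys. star_commute x y \<Longrightarrow> star_commute x (ordered_prod ys)"
  by (induction ys rule: ordered_prod.induct) (auto intro: star_commute_mult)

text \<open>Since \<open>x\<close> commutes with \<open>y\<close> and with the projections
  \<open>y * z\<close> and \<open>z * y\<close>, it can be moved through z = z y z one factor at a
  time.\<close>

lemma commute_mp_inverse:
  assumes xy: "star_commute x y" and mp: "is_mp_inverse y z"
  shows "x * z = z * x"
proof -
  have yzy: "y * z * y = y" and zyz: "z * y * z = z" and saq: "star (z * y) = z * y"
    and sap: "star (y * z) = y * z"
    by (simp_all add: is_mp_inverseD[OF mp])
  \<comment> \<open>An element commuting with \<open>y\<close> leaves the range of
    \<open>y * z\<close> and the kernel of \<open>z * y\<close> invariant.\<close>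
  have p1: "(y * z) * (u * (y * z)) = u * (y * z)"
    and q1: "(z * y) * (u * (z * y)) = (z * y) * u" if "star_commute u y" for u
  proof -
    have u: "u * y = y * u" using that by (simp add: star_commute_def)
    have "(y * z) * (u * (y * z)) = (y * z) * (u * y) * z" by (simp add: mult.assoc)
    also have "\<dots> = (y * z * y) * u * z" unfolding u by (simp add: mult.assoc)
    finally show "(y * z) * (u * (y * z)) = u * (y * z)" unfolding yzy u[symmetric] by (simp add: mult.assoc)
    have "(z * y) * (u * (z * y)) = z * (y * u) * (z * y)" by (simp add: mult.assoc)
    also have "\<dots> = z * (u * (y * z * y))" unfolding u[symmetric] by (simp add: mult.assoc)
    finally show "(z * y) * (u * (z * y)) = (z * y) * u" unfolding yzy u by (simp add: mult.assoc)
  qed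
  \<comment> \<open>Used with u = star x: the adjoint of the invariance for \<open>star x\<close> is
    the mirrored identity for \<open>x\<close>, and the two together give commutation with the
    projection.\<close>
  have adjoint: "r * (star u * r) = star v" if "star r = r" "r * (u * r) = v" for r u v :: 'a
    using that(1) by (simp add: star_mult mult.assoc flip: that(2))
  note xs = star_commute_star[OF xy]
  have "(y * z) * (x * (y * z)) = (y * z) * x"
    using adjoint[OF sap p1[OF xs]] by (simp only: star_mult[of "star x"] sap star_star)
  with p1[OF xy] have p: "x * (y * z) = (y * z) * x" by simp
  have "(z * y) * (x * (z * y)) = x * (z * y)"
    using adjoint[OF saq q1[OF xs]] by (simp only: star_mult[of _ "star x"] saq star_star)
  with q1[OF xy] have q: "x * (z * y) = (z * y) * x" by simp
  have yx: "x * y = y * x" using xy by (simp add: star_commute_def)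
  have "z * x = z * (y * z * x)" using zyz by (simp flip: mult.assoc)
  also have "\<dots> = z * (x * y) * z" unfolding p[symmetric] by (simp add: mult.assoc)
  also have "\<dots> = (z * y * x) * z" unfolding yx by (simp add: mult.assoc)
  also have "\<dots> = x * (z * y * z)" unfolding q[symmetric] by (simp add: mult.assoc)
  finally show ?thesis by (simp add: zyz)
qed

lemma star_commute_mp_inverse:
  assumes "star_commute x y" "is_mp_inverse y z"
  shows "star_commute x z"
  \<comment> \<open>Taking adjoints in the commutation of \<open>star x\<close> with
    \<open>z\<close> gives that of \<open>x\<close> with \<open>star z\<close>.\<close>
  using commute_mp_inverse[OF assms] commute_mp_inverse[OF star_commute_star[OF assms(1)] assms(2)]
  unfolding star_commute_def by (metis star_mult star_star)

section \<open>Moore-Penrose inverses of products\<close>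

lemma is_mp_inverse_mult:
  assumes xy: "star_commute x y" and x: "is_mp_inverse x x'" and y: "is_mp_inverse y y'"
  shows "is_mp_inverse (x * y) (x' * y')"
proof -
  have xy': "star_commute x y'" by (rule star_commute_mp_inverse[OF xy y])
  have yx': "star_commute y x'" by (rule star_commute_mp_inverse[OF star_commute_sym[OF xy] x])
  have x'y': "star_commute x' y'"
    by (rule star_commute_sym[OF star_commute_mp_inverse[OF star_commute_sym[OF xy'] x]])
  have comm: "y * x = x * y" "y' * x = x * y'" "y * x' = x' * y" "y' * x' = x' * y'"
    using xy xy' yx' x'y' by (simp_all add: star_commute_def)
  have left_comm: "y * (x * v) = x * (y * v)" "y' * (x * v) = x * (y' * v)"
    "y * (x' * v) = x' * (y * v)" "y' * (x' * v) = x' * (y' * v)" for v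
    using comm by (simp_all flip: mult.assoc)
  \<comment> \<open>Normal form: right-nested products with \<open>x\<close> and \<open>x'\<close>
    moved to the left of \<open>y\<close> and \<open>y'\<close>, each pair keeping its own
    order.\<close>
  note comms = mult.assoc comm left_comm
  have l: "(x * y) * (x' * y') = (x * x') * (y * y')" "(x * x') * (y * y') = (y * y') * (x * x')"
    and r: "(x' * y') * (x * y) = (x' * x) * (y' * y)" "(x' * x) * (y' * y) = (y' * y) * (x' * x)"
    by (simp_all add: comms)
  have "(x * x') * (y * y') * (x * y) = (x * x' * x) * (y * y' * y)"
    and "(x' * x) * (y' * y) * (x' * y') = (x' * x * x') * (y' * y * y')"
    by (simp_all add: comms)
  moreover have "star ((x * x') * (y * y')) = (x * x') * (y * y')"
    unfolding star_mult[of "x * x'"] is_mp_inverseD[OF x] is_mp_inverseD[OF y] by (rule l(2)[symmetric])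
  moreover have "star ((x' * x) * (y' * y)) = (x' * x) * (y' * y)"
    unfolding star_mult[of "x' * x"] is_mp_inverseD[OF x] is_mp_inverseD[OF y] by (rule r(2)[symmetric])
  ultimately show ?thesis
    unfolding is_mp_inverse_def l(1) r(1)
    by (simp add: is_mp_inverseD[OF x] is_mp_inverseD[OF y])
qed

text \<open>By induction the inverse arises in the original order of the factors; the reversed order
  comes from \<open>ordered_prod_rev\<close>.\<close>

lemma is_mp_inverse_ordered_prod:
  assumes "xs \<noteq> []" "\<forall>x\<in>set xs. regular x" "sorted_wrt star_commute xs"
  shows "is_mp_inverse (ordered_prod xs) (ordered_prod (map mp_inverse xs))"
  using assms
proof (induction xs rule: ordered_prod.induct)
  case (2 x y ys)
  then show ?case
    using star_commute_ordered_prod[of "y # ys" x]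
    by (auto intro!: is_mp_inverse_mult regular_is_mp_inverse)
qed (auto intro: regular_is_mp_inverse)

lemma ordered_prod_snoc:
  "xs \<noteq> [] \<Longrightarrow> ordered_prod (xs @ [y]) = ordered_prod xs * y"
proof (induction xs rule: ordered_prod.induct)
  case (2 x x' xs)
  then show ?case by (simp add: mult.assoc)
qed auto

lemma ordered_prod_rev:
  assumes "sorted_wrt star_commute xs"
  shows "ordered_prod (rev xs) = ordered_prod xs"
  using assms
proof (induction xs rule: ordered_prod.induct)
  case (2 x y ys)
  then have "star_commute x (ordered_prod (y # ys))"
    by (intro star_commute_ordered_prod) auto
  with 2 show ?case
    using ordered_prod_snoc[of "rev (y # ys)" x] by (simp add: star_commute_def)
qed auto

theorem theorem2p4:
  fixes a :: "nat \<Rightarrow> 'a::c_star_algebra" and n :: nat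
  assumes "n \<ge> 1"
    and "\<forall>i\<in>{1..n}. regular (a i)"
    and "doubly_commuting n a"
  shows "regular (ordered_prod (map a [1..<n+1])) \<and>
    mp_inverse (ordered_prod (map a [1..<n+1]))
      = ordered_prod (map (\<lambda>i. mp_inverse (a (n - i))) [0..<n]) \<and>
    ordered_prod (map (\<lambda>i. mp_inverse (a (n - i))) [0..<n])
      = ordered_prod (map (\<lambda>i. mp_inverse (a i)) [1..<n+1])"
proof -
  let ?xs = "map a [1..<n+1]"
  have comm: "star_commute (a i) (a j)" if "i \<in> {1..n}" "j \<in> {1..n}" "i \<noteq> j" for i j
    using that assms(3) by (simp add: doubly_commuting_def star_commute_def)
  have mp: "is_mp_inverse (a i) (mp_inverse (a i))" if "i \<in> {1..n}" for i
    using that assms(2) by (simp add: regular_is_mp_inverse)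
  have "sorted_wrt star_commute ?xs"
    unfolding sorted_wrt_map
    \<comment> \<open>The index list is strictly increasing, so any two of its positions carry
      distinct indices.\<close>
    by (rule sorted_wrt_mono_rel[OF _ sorted_wrt_upt]) (auto intro!: comm)
  then have prod: "is_mp_inverse (ordered_prod ?xs) (ordered_prod (map mp_inverse ?xs))"
    using assms(1,2) by (intro is_mp_inverse_ordered_prod) auto
  have "star_commute (mp_inverse (a i)) (mp_inverse (a j))"
    if "i \<in> {1..n}" "j \<in> {1..n}" "i \<noteq> j" for i j
    using comm[OF that] mp that by (meson star_commute_mp_inverse star_commute_sym)
  then have sorted': "sorted_wrt star_commute (map (\<lambda>i. mp_inverse (a i)) [1..<n+1])"
    unfolding sorted_wrt_map
    by (intro sorted_wrt_mono_rel[OF _ sorted_wrt_upt]) auto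
  \<comment> \<open>As \<open>i\<close> runs from 0 to n - 1, the index n - i runs from n down to
    1.\<close>
  have "map (\<lambda>i. mp_inverse (a (n - i))) [0..<n] = rev (map (\<lambda>i. mp_inverse (a i)) [1..<n+1])"
    by (rule nth_equalityI) (auto simp: rev_nth Suc_diff_Suc simp del: upt_Suc)
  then have "ordered_prod (map (\<lambda>i. mp_inverse (a (n - i))) [0..<n])
      = ordered_prod (map (\<lambda>i. mp_inverse (a i)) [1..<n+1])"
    by (simp only: ordered_prod_rev[OF sorted'])
  moreover have "map mp_inverse ?xs = map (\<lambda>i. mp_inverse (a i)) [1..<n+1]"
    by simp
  ultimately show ?thesis
    using regular_if_mp_inverse[OF prod] mp_inverse_eq[OF prod] by metis
qed

end
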